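(* Let $(A,\dashv,\perp,\vdash)$ be a triassociative algebra over a field $\mathbb{K}$, let $\theta:A\to A$ be an element of the centroid of $A$ and let $\beta:A\to A$ be an injective averaging operator on $A$. Then $A$ is a triassociative algebra with respect to each of the following two sets of (left, middle, right) multiplications (for all $x,y\in A$): (i) $x\triangleleft y=\theta(x)\dashv y$, $\;x\triangle y=\theta(x)\perp y$, $\;x\triangleright y=\theta(x)\vdash y$; (ii) $x\triangleleft y=\beta(x)\dashv y$, $\;x\triangle y=\beta(x)\perp y$, $\;x\triangleright y=\beta(x)\vdash y$.
   Context: A triassociative algebra over $\mathbb{K}$ is a $\mathbb{K}$-vector space $A$ with three bilinear maps $\dashv,\perp,\vdash:A\times A\to A$ (left, middle, right) such that for all $x,y,z\in A$: (1) $(x\dashv y)\dashv z=x\dashv(y\dashv z)$; (2) $(x\vdash y)\vdash z=x\vdash(y\vdash z)$; (3) $(x\perp y)\perp z=x\perp(y\perp z)$; (4) $(x\dashv y)\dashv z=x\dashv(y\vdash z)$; (5) $(x\dashv y)\dashv z=x\dashv(y\perp z)$; (6) $(x\vdash y)\dashv z=x\vdash(y\dashv z)$; (7) $(x\dashv y)\vdash z=x\vdash(y\vdash z)$; (8) $(x\perp y)\vdash z=x\vdash(y\vdash z)$; (9) $(x\perp y)\dashv z=x\perp(y\dashv z)$; (10) $(x\dashv y)\perp z=x\perp(y\vdash z)$; (11) $(x\vdash y)\perp z=x\vdash(y\perp z)$. An element of the centroid of $A$ is a linear map $\theta:A\to A$ with $\theta(x\ast y)=\theta(x)\ast y=x\ast\theta(y)$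 for all $x,y\in A$ and $\ast\in\{\dashv,\perp,\vdash\}$. An averaging operator on $A$ is a linear map $\theta:A\to A$ with $\theta(x)\ast\theta(y)=\theta(\theta(x)\ast y)=\theta(x\ast\theta(y))$ for all $x,y\in A$ and $\ast\in\{\dashv,\perp,\vdash\}$. *)

theory Defs
  imports "HOL.Vector_Spaces"
begin

locale bilinear_map =
  vector_space scale
  for scale :: "'k::field \<Rightarrow> 'a::ab_group_add \<Rightarrow> 'a" +
  fixes f :: "'a \<Rightarrow> 'a \<Rightarrow> 'a"
  assumes linear_left: "Vector_Spaces.linear scale scale (\<lambda>x. f x y)"
    and linear_right: "Vector_Spaces.linear scale scale (\<lambda>y. f x y)"

locale triassociative_algebra =
  vector_space scale +
  left: bilinear_map scale lft +
  middle: bilinear_map scale mid +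
  right: bilinear_map scale rgt
  for scale :: "'k::field \<Rightarrow> 'a::ab_group_add \<Rightarrow> 'a"
    and lft :: "'a \<Rightarrow> 'a \<Rightarrow> 'a"  (infixl \<open>\<stileturn>\<close> 70)
    and mid :: "'a \<Rightarrow> 'a \<Rightarrow> 'a"  (infixl \<open>\<bottom>\<close> 70)
    and rgt :: "'a \<Rightarrow> 'a \<Rightarrow> 'a"  (infixl \<open>\<turnstile>\<close> 70) +
  assumes tri1: "(x \<stileturn> y) \<stileturn> z = x \<stileturn> (y \<stileturn> z)"
    and tri2: "(x \<turnstile> y) \<turnstile> z = x \<turnstile> (y \<turnstile> z)"
    and tri3: "(x \<bottom> y) \<bottom> z = x \<bottom> (y \<bottom> z)"
    and tri4: "(x \<stileturn> y) \<stileturn> z = x \<stileturn> (y \<turnstile> z)"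
    and tri5: "(x \<stileturn> y) \<stileturn> z = x \<stileturn> (y \<bottom> z)"
    and tri6: "(x \<turnstile> y) \<stileturn> z = x \<turnstile> (y \<stileturn> z)"
    and tri7: "(x \<stileturn> y) \<turnstile> z = x \<turnstile> (y \<turnstile> z)"
    and tri8: "(x \<bottom> y) \<turnstile> z = x \<turnstile> (y \<turnstile> z)"
    and tri9: "(x \<bottom> y) \<stileturn> z = x \<bottom> (y \<stileturn> z)"
    and tri10: "(x \<stileturn> y) \<bottom> z = x \<bottom> (y \<turnstile> z)"
    and tri11: "(x \<turnstile> y) \<bottom> z = x \<turnstile> (y \<bottom> z)"

definition centroid ::
  "('k::field \<Rightarrow> 'a::ab_group_add \<Rightarrow> 'a) \<Rightarrow> ('a \<Rightarrow> 'a \<Rightarrow> 'a) \<Rightarrow> ('a \<Rightarrow> 'a \<Rightarrow> 'a) \<Rightarrow>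
    ('a \<Rightarrow> 'a \<Rightarrow> 'a) \<Rightarrow> ('a \<Rightarrow> 'a) set" where
  "centroid scale lft mid rgt =
    {\<theta>. Vector_Spaces.linear scale scale \<theta> \<and>
      (\<forall>f\<in>{lft, mid, rgt}. \<forall>x y. \<theta> (f x y) = f (\<theta> x) y \<and> f (\<theta> x) y = f x (\<theta> y))}"

definition averaging_operator ::
  "('k::field \<Rightarrow> 'a::ab_group_add \<Rightarrow> 'a) \<Rightarrow> ('a \<Rightarrow> 'a \<Rightarrow> 'a) \<Rightarrow> ('a \<Rightarrow> 'a \<Rightarrow> 'a) \<Rightarrow>
    ('a \<Rightarrow> 'a \<Rightarrow> 'a) \<Rightarrow> ('a \<Rightarrow> 'a) \<Rightarrow> bool" where
  "averaging_operator scale lft mid rgt \<theta> \<longleftrightarrow>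
    Vector_Spaces.linear scale scale \<theta> \<and>
    (\<forall>f\<in>{lft, mid, rgt}. \<forall>x y.
      f (\<theta> x) (\<theta> y) = \<theta> (f (\<theta> x) y) \<and> \<theta> (f (\<theta> x) y) = \<theta> (f x (\<theta> y)))"

end

theory Submission
  imports Defs
begin

text \<open>
  Both twists satisfy \<open>\<phi> (\<phi> x * y) = \<phi> x * \<phi> y\<close> for each of the three products \<open>*\<close>. This turns
  each axiom for the new products at \<open>x, y, z\<close> into the same axiom for the old products at
  \<open>\<phi> x, \<phi> y, z\<close>.
\<close>

text \<open>The twist enters only the first slot: there it is composed with a linear map, and in the
  second slot \<open>f\<close> is merely evaluated at the fixed argument
  \<open>\<phi> x\<close>.\<close>

lemma bilinear_map_twist:
  assumes "bilinear_map scale f" and "Vector_Spaces.linear scale scale \<phi>"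
  shows "bilinear_map scale (\<lambda>x y. f (\<phi> x) y)"
proof -
  interpret bilinear_map scale f by fact
  show ?thesis
  proof (intro bilinear_map.intro bilinear_map_axioms.intro vector_space_axioms)
    show "Vector_Spaces.linear scale scale (\<lambda>x. f (\<phi> x) y)" for y
      using Vector_Spaces.linear_compose[OF assms(2) linear_left[of y]] by (simp add: comp_def)
    show "Vector_Spaces.linear scale scale (\<lambda>y. f (\<phi> x) y)" for x
      by (rule linear_right)
  qed
qed

text \<open>Serves both twists at once: \<open>mult\<close> is the identity shared by centroid
  elements and averaging operators.\<close>

lemma triassociative_algebra_twist:
  assumes tri: "triassociative_algebra scale lft mid rgt"
    and lin: "Vector_Spaces.linear scale scale \<phi>"
    and mult: "\<And>f x y. f \<in> {lft, mid, rgt} \<Longrightarrow> \<phi> (f (\<phi> x) y) = f (\<phi> x) (\<phi> y)"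
  shows "triassociative_algebra scale
           (\<lambda>x y. lft (\<phi> x) y) (\<lambda>x y. mid (\<phi> x) y) (\<lambda>x y. rgt (\<phi> x) y)"
proof -
  interpret triassociative_algebra scale lft mid rgt by (rule tri)
  note bilinear =
    bilinear_map_twist[OF left.bilinear_map_axioms lin]
    bilinear_map_twist[OF middle.bilinear_map_axioms lin]
    bilinear_map_twist[OF right.bilinear_map_axioms lin]
  \<comment> \<open>Three unconditional instances of \<open>mult\<close>, with concrete heads,
    usable for unfolding.\<close>
  have mult':
    "\<phi> (lft (\<phi> x) y) = lft (\<phi> x) (\<phi> y)"
    "\<phi> (mid (\<phi> x) y) = mid (\<phi> x) (\<phi> y)"
    "\<phi> (rgt (\<phi> x) y) = rgt (\<phi> x) (\<phi> y)" for x y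
    by (simp_all add: mult)
  \<comment> \<open>Only the left-hand sides contain \<open>\<phi>\<close> of a product, since on
    the right the inner product sits in the untwisted slot.\<close>
  show ?thesis
    by (intro triassociative_algebra.intro triassociative_algebra_axioms.intro
        vector_space_axioms bilinear; unfold mult')
      (rule tri1 tri2 tri3 tri4 tri5 tri6 tri7 tri8 tri9 tri10 tri11)+
qed

theorem theorem2p2:
  fixes scale :: "'k::field \<Rightarrow> 'a::ab_group_add \<Rightarrow> 'a"
    and lft mid rgt :: "'a \<Rightarrow> 'a \<Rightarrow> 'a"
    and \<theta> \<beta> :: "'a \<Rightarrow> 'a"
  assumes "triassociative_algebra scale lft mid rgt"
    and "\<theta> \<in> centroid scale lft mid rgt"
    and "averaging_operator scale lft mid rgt \<beta>"
    and "inj \<beta>"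
  shows "triassociative_algebra scale
           (\<lambda>x y. lft (\<theta> x) y) (\<lambda>x y. mid (\<theta> x) y) (\<lambda>x y. rgt (\<theta> x) y) \<and>
         triassociative_algebra scale
           (\<lambda>x y. lft (\<beta> x) y) (\<lambda>x y. mid (\<beta> x) y) (\<lambda>x y. rgt (\<beta> x) y)"
proof
  \<comment> \<open>The centroid law \<open>\<theta> (f u y) = f u (\<theta> y)\<close> is taken at
    \<open>u = \<theta> x\<close>.\<close>
  have "Vector_Spaces.linear scale scale \<theta>"
    and "\<And>f x y. f \<in> {lft, mid, rgt} \<Longrightarrow> \<theta> (f (\<theta> x) y) = f (\<theta> x) (\<theta> y)"
    using assms(2) unfolding centroid_def mem_Collect_eq by (blast, metis)
  then show "triassociative_algebra scale
      (\<lambda>x y. lft (\<theta> x) y) (\<lambda>x y. mid (\<theta> x) y) (\<lambda>x y. rgt (\<theta> x) y)"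
    by (rule triassociative_algebra_twist[OF assms(1)])
  \<comment> \<open>Here the identity is the first averaging equation read from right to
    left.\<close>
  have "Vector_Spaces.linear scale scale \<beta>"
    and "\<And>f x y. f \<in> {lft, mid, rgt} \<Longrightarrow> \<beta> (f (\<beta> x) y) = f (\<beta> x) (\<beta> y)"
    using assms(3) unfolding averaging_operator_def by (blast, metis)
  then show "triassociative_algebra scale
      (\<lambda>x y. lft (\<beta> x) y) (\<lambda>x y. mid (\<beta> x) y) (\<lambda>x y. rgt (\<beta> x) y)"
    by (rule triassociative_algebra_twist[OF assms(1)])
qed

end
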